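(* Let $X$ be a source with finite alphabet and distribution $P_X$, let $d(x^n,x'^n)=\frac1n\sum_{i=1}^n d_{\mathrm{sym}}(x_i,x'_i)$ be a symbolwise distortion function with $0\le d_{\mathrm{sym}}(x,x')\le1$ for all $x,x'$, where the reconstruction symbols $x'$ are binary, and let $\bar d\le 1$. Suppose $P_{XX'}$ is a joint distribution (with $X$-marginal $P_X$) such that $\mathbb E_{P_{XX'}}d_{\mathrm{sym}}(X,X')\le\bar d$, and let $(X^n,X'^n)\sim P_{XX'}^{\times n}$. Then any linear $(k,\varepsilon)$ privacy amplification protocol for $X'^n$ relative to $X^n$ can be used to construct an $(n-k,\ \bar d+\varepsilon)$ lossy compression scheme for $X^n\sim P_X^{\times n}$.
   Context: Logarithms are to base 2. $R_V$ denotes the uniform distribution on the alphabet of $V$, $\delta(P,Q)=\tfrac12\|P-Q\|_1$ is the variational distance, and $P^{\times n}$ is the $n$-fold i.i.d. product. Privacy amplification: for a joint distribution $P_{YZ}$, a function $f:Y\to V$ is a protocol for $(k,\varepsilon)$ privacy amplification of $Y$ relative to $Z$ if, with $V=f(Y)$, $\log|V|=k$ and $\delta(P_{VZ},R_V\times P_Z)\le\varepsilon$. The protocol is linear if $f$ is a linear function; here $Y=X'^n$ takes values in $\mathbb F_2^n$ and $Z=X^n$. Lossy compression (average distortion): an $(m,D_0)$ lossy compression scheme for $X^n$ consists of an encoder $E$ from the alphabet of $X^n$ to a finite set $\mathcal C$ with $\log|\mathcal C|=m$ and a decoder $D$ from $\mathcal C$ to the alphabet of $X'^n$ such that $\mathbb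 E\,d(X^n,D(E(X^n)))\le D_0$. *)

theory Defs
  imports "HOL-Probability.Probability" "HOL-Library.Z2"
begin

instance bit :: finite
proof
  have "(UNIV :: bit set) = {0, 1}"
    by (auto intro: bit_not_zero_iff [THEN iffD1])
  then show "finite (UNIV :: bit set)"
    by (metis finite.emptyI finite.insertI)
qed

definition variational_distance :: "'a::finite pmf \<Rightarrow> 'a pmf \<Rightarrow> real" where
  "variational_distance P Q = 1 / 2 * (\<Sum>a\<in>UNIV. \<bar>pmf P a - pmf Q a\<bar>)"

(* The default value of Pi_pmf is irrelevant because the index set is the whole type. *)
definition iid_pmf :: "'a pmf \<Rightarrow> ('a ^ 'n::finite) pmf" where
  "iid_pmf P = map_pmf vec_lambda (Pi_pmf UNIV undefined (\<lambda>_. P))"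

(* The alphabet of V is the whole codomain type of f; f need not be surjective. *)
definition privacy_amplification ::
  "('y \<times> 'z::finite) pmf \<Rightarrow> ('y \<Rightarrow> 'v::finite) \<Rightarrow> real \<Rightarrow> real \<Rightarrow> bool" where
  "privacy_amplification PYZ f k \<epsilon> \<longleftrightarrow>
     log 2 (real CARD('v)) = k \<and>
     variational_distance
       (map_pmf (\<lambda>(y, z). (f y, z)) PYZ)
       (pair_pmf (pmf_of_set (UNIV :: 'v set)) (map_pmf snd PYZ)) \<le> \<epsilon>"

(* The distribution of (X'^n, X^n), the reconstruction sequence coming first,
   where (X^n, X'^n) is distributed according to the n-fold product of P. *)
definition reconstruction_source_pmf ::
  "('x \<times> 'y) pmf \<Rightarrow> (('y ^ 'n::finite) \<times> ('x ^ 'n)) pmf" where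
  "reconstruction_source_pmf P =
     map_pmf (\<lambda>w. ((\<chi> i. snd (w $ i)), (\<chi> i. fst (w $ i)))) (iid_pmf P)"

definition avg_distortion ::
  "('x \<Rightarrow> 'y \<Rightarrow> real) \<Rightarrow> 'x ^ 'n::finite \<Rightarrow> 'y ^ 'n \<Rightarrow> real" where
  "avg_distortion dsym x x' = 1 / real CARD('n) * (\<Sum>i\<in>UNIV. dsym (x $ i) (x' $ i))"

definition lossy_compression_scheme ::
  "'a pmf \<Rightarrow> ('a \<Rightarrow> 'b \<Rightarrow> real) \<Rightarrow> 'c set \<Rightarrow> ('a \<Rightarrow> 'c) \<Rightarrow> ('c \<Rightarrow> 'b) \<Rightarrow> real \<Rightarrow> real \<Rightarrow> bool" where
  "lossy_compression_scheme P d C E D m D0 \<longleftrightarrow>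
     finite C \<and> range E \<subseteq> C \<and> log 2 (real (card C)) = m \<and>
     measure_pmf.expectation P (\<lambda>x. d x (D (E x))) \<le> D0"

end

theory Submission
  imports Defs
begin

text \<open>
  Let \<open>W = range f\<close> and let \<open>m x v\<close> be the least distortion between \<open>x\<close> and a point of the fibre
  of \<open>v\<close>, with \<open>m x v = 1\<close> for \<open>v \<notin> W\<close>. Since \<open>m x (f y) \<le> d x y\<close>, the mean of \<open>m\<close> under the true
  distribution of \<open>(f X', X)\<close> is at most \<open>dbar\<close>; as \<open>0 \<le> m \<le> 1\<close>, its mean under the product of the
  uniform distribution on \<open>V\<close> and \<open>P\<^sub>X\<close> exceeds this by at most \<open>\<epsilon>\<close>.

  If \<open>f\<close> is surjective, some fibre (a coset of the kernel, of size \<open>2 ^ (n - k)\<close>) does at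
  least as well as the average, and it serves as the codebook. If \<open>f\<close> is not surjective, its fibres
  are too large. They are then cut into \<open>K = |V| / |W|\<close> blocks of size \<open>2 ^ (n - k)\<close>: over the
  blocks of one fibre, the least distortions sum to at most \<open>(K - 1) + m x w\<close>, because one
  block contains the minimiser of the whole fibre. Summed over \<open>w \<in> W\<close> this is \<open>\<Sum>v. m x v\<close>, so
  again some block does at least as well as the average of \<open>m\<close>.
\<close>

section \<open>Cardinalities over the two-element field\<close>

text \<open>The only scalars are 0 and 1, so adjoining a vector outside the span adds exactly one
  translate of it, disjoint from it: each basis vector doubles the cardinality.\<close>

lemma card_span_bit:
  fixes scale :: "bit \<Rightarrow> 'b \<Rightarrow> 'b::ab_group_add"
  assumes "vector_space scale" "finite S" "\<not> module.dependent scale S"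
  shows "finite (module.span scale S) \<and> card (module.span scale S) = 2 ^ card S"
proof -
  interpret vector_space scale by fact
  show ?thesis
    using assms(2,3)
  proof (induction S)
    case empty
    then show ?case by simp
  next
    case (insert a S)
    have ind: "independent S" and a: "a \<notin> span S"
      using insert by (auto simp: independent_insert)
    have IH: "finite (span S)" "card (span S) = 2 ^ card S"
      using insert.IH[OF ind] by auto
    have bit: "k = 0 \<or> k = 1" for k :: bit
      by (cases k) auto
    have eq: "span (insert a S) = span S \<union> (\<lambda>x. x + a) ` span S"
    proof (intro set_eqI iffI)
      fix x assume "x \<in> span (insert a S)"
      then obtain k where "x - scale k a \<in> span S"
        by (auto simp: span_insert)
      then show "x \<in> span S \<union> (\<lambda>x. x + a) ` span S"
        using bit[of k] by (auto intro!: image_eqI[of _ _ "x - a"])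
    next
      fix x assume "x \<in> span S \<union> (\<lambda>x. x + a) ` span S"
      then show "x \<in> span (insert a S)"
        by (auto intro: span_add span_base subsetD[OF span_mono[of S "insert a S"]])
    qed
    have "span S \<inter> (\<lambda>x. x + a) ` span S = {}"
    proof -
      have False if "x + a \<in> span S" "x \<in> span S" for x
        using span_diff[OF that] a by simp
      then show ?thesis by blast
    qed
    moreover have "card ((\<lambda>x. x + a) ` span S) = card (span S)"
      by (intro card_image) (auto simp: inj_on_def)
    ultimately show ?case
      using IH insert by (simp add: eq card_Un_disjoint)
  qed
qed

text \<open>Applied both to the codomain of \<open>f\<close> and to \<open>range f\<close>: two
  powers of two have an integral quotient, the number of blocks per fibre.\<close>

lemma card_subspace_bit:
  fixes scale :: "bit \<Rightarrow> 'b \<Rightarrow> 'b::ab_group_add"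
  assumes "vector_space scale" "module.subspace scale W" "finite W"
  obtains r where "card W = 2 ^ r"
proof -
  interpret vector_space scale by fact
  obtain B where B: "B \<subseteq> W" "independent B" "W \<subseteq> span B"
    using maximal_independent_subset by blast
  have "W = span B"
    using B assms(2) span_minimal by blast
  then have "card W = 2 ^ card B"
    using card_span_bit[OF assms(1) finite_subset[OF B(1) assms(3)] B(2)] by simp
  then show ?thesis using that by blast
qed

text \<open>Nonempty fibres are translates of the kernel, hence all of one size, and they partition
  the domain.\<close>

lemma card_fibre:
  fixes f :: "'a::{finite, ab_group_add} \<Rightarrow> 'b::ab_group_add"
  assumes add: "\<And>x y. f (x + y) = f x + f y" and "w \<in> range f"
  shows "card (f -` {w}) * card (range f) = CARD('a)"
proof -
  have kernel: "card (f -` {v}) = card (f -` {0})" if v: "v \<in> range f" for v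
  proof -
    obtain y where y: "v = f y" using v by blast
    have diff: "f (x - y) = f x - f y" for x
      using add[of "x - y" y] by (simp add: algebra_simps)
    have "f -` {v} = (\<lambda>x. x + y) ` (f -` {0})"
      by (auto simp: add y diff intro!: image_eqI[of _ _ "_ - y"])
    then show ?thesis
      by (simp add: card_image inj_on_def)
  qed
  have "(UNIV :: 'a set) = (\<Union>v\<in>range f. f -` {v})" by auto
  then have "CARD('a) = card (\<Union>v\<in>range f. f -` {v})" by simp
  also have "\<dots> = (\<Sum>v\<in>range f. card (f -` {v}))"
    by (rule card_UN_disjoint) auto
  also have "\<dots> = (\<Sum>v\<in>range f. card (f -` {w}))"
    by (intro sum.cong) (auto simp: kernel assms(2))
  finally show ?thesis by (simp add: mult.commute)
qed

section \<open>Cutting a set into blocks\<close>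

lemma equal_blocks:
  assumes "finite A" "card A = K * M"
  obtains B :: "nat \<Rightarrow> 'a set"
  where "\<And>i. i < K \<Longrightarrow> card (B i) = M" "A = (\<Union>i<K. B i)"
  using assms
proof (induction K arbitrary: A thesis)
  case 0
  then show ?case by auto
next
  case (Suc K)
  obtain T where T: "T \<subseteq> A" "card T = M"
    using obtain_subset_with_card_n[of M A] Suc.prems(3) by (metis le_add1 mult_Suc)
  have "card (A - T) = K * M"
    using T Suc.prems finite_subset by (subst card_Diff_subset) auto
  then obtain B where B: "\<And>i. i < K \<Longrightarrow> card (B i) = M" "A - T = (\<Union>i<K. B i)"
    using Suc.IH[of "A - T"] Suc.prems(2) by blast
  have "(\<Union>i<Suc K. (B(K := T)) i) = T \<union> (\<Union>i<K. B i)"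
    by (auto simp: lessThan_Suc)
  then have "A = (\<Union>i<Suc K. (B(K := T)) i)"
    using T B(2) by auto
  moreover have "card ((B(K := T)) i) = M" if "i < Suc K" for i
    using that T B(1) by (auto simp: less_Suc_eq)
  ultimately show ?case
    using Suc.prems(1) by blast
qed

text \<open>A block holding a minimiser over \<open>A\<close> contributes at most the minimum over
  \<open>A\<close>; each of the other \<open>K - 1\<close> blocks contributes at most 1.\<close>

lemma sum_Min_blocks_le:
  fixes g :: "'a \<Rightarrow> real"
  assumes A: "A = (\<Union>i<K. B i)" "finite A" "A \<noteq> {}"
    and B: "\<And>i. i < K \<Longrightarrow> B i \<noteq> {}" and g: "\<And>y. g y \<le> 1"
  shows "(\<Sum>i<K. Min (g ` B i)) \<le> real K - 1 + Min (g ` A)"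
proof -
  have fin: "finite (B i)" if "i < K" for i
    using A(1,2) that by (metis finite_subset UN_upper lessThan_iff)
  have "Min (g ` A) \<in> g ` A" using A(2,3) by simp
  then obtain y j where y: "Min (g ` A) = g y" and j: "j < K" "y \<in> B j"
    using A(1) by auto
  have "Min (g ` B i) \<le> 1" if i: "i < K" for i
    using Min_in[of "g ` B i"] fin[OF i] B[OF i] g
    by (metis finite_imageI image_iff image_is_empty)
  then have "(\<Sum>i\<in>{..<K} - {j}. Min (g ` B i)) \<le> (\<Sum>i\<in>{..<K} - {j}. 1)"
    by (intro sum_mono) auto
  also have "\<dots> = real K - 1"
    using j(1) by simp
  finally have "(\<Sum>i\<in>{..<K} - {j}. Min (g ` B i)) \<le> real K - 1" .
  moreover have "Min (g ` B j) \<le> g y"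
    using fin[OF j(1)] j(2) by simp
  ultimately show ?thesis
    using j(1) by (subst sum.remove[of _ j]) (auto simp: y)
qed

section \<open>Expectations and variational distance\<close>

lemma expectation_le_variational_distance:
  fixes P Q :: "'a::finite pmf" and g :: "'a \<Rightarrow> real"
  assumes "\<And>a. 0 \<le> g a" "\<And>a. g a \<le> 1"
  shows "measure_pmf.expectation Q g \<le> measure_pmf.expectation P g + variational_distance P Q"
proof -
  have total: "(\<Sum>a\<in>UNIV. pmf R a) = 1" for R :: "'a pmf"
    by (rule sum_pmf_eq_1) auto
  \<comment> \<open>\<open>P\<close> and \<open>Q\<close> have equal mass, so \<open>g\<close> may be shifted by \<open>1/2\<close>, which makes it at most \<open>1/2\<close> in
    absolute value.\<close>
  have "(\<Sum>a\<in>UNIV. g a * pmf Q a) - (\<Sum>a\<in>UNIV. g a * pmf P a)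
      = (\<Sum>a\<in>UNIV. (g a - 1/2) * (pmf Q a - pmf P a))"
    by (simp add: algebra_simps sum.distrib sum_subtractf total flip: sum_divide_distrib)
  also have "\<dots> \<le> (\<Sum>a\<in>UNIV. 1/2 * \<bar>pmf P a - pmf Q a\<bar>)"
  proof (rule sum_mono)
    fix a
    have "(g a - 1/2) * (pmf Q a - pmf P a) \<le> \<bar>g a - 1/2\<bar> * \<bar>pmf Q a - pmf P a\<bar>"
      by (metis abs_ge_self abs_mult)
    also have "\<dots> \<le> 1/2 * \<bar>pmf Q a - pmf P a\<bar>"
      using assms[of a] by (intro mult_right_mono) arith+
    finally show "(g a - 1/2) * (pmf Q a - pmf P a) \<le> 1/2 * \<bar>pmf P a - pmf Q a\<bar>"
      by (simp add: abs_minus_commute)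
  qed
  finally show ?thesis
    by (simp add: variational_distance_def sum_distrib_left
        integral_measure_pmf_real[where A = UNIV])
qed

lemma expectation_mono_finite:
  fixes g h :: "'a::finite \<Rightarrow> real"
  assumes "\<And>a. g a \<le> h a"
  shows "measure_pmf.expectation P g \<le> measure_pmf.expectation P h"
  by (intro integral_mono assms) (auto intro: integrable_measure_pmf_finite)

lemma expectation_uniform_pair:
  fixes P :: "'z::finite pmf" and g :: "'v::finite \<times> 'z \<Rightarrow> real"
  shows "measure_pmf.expectation (pair_pmf (pmf_of_set UNIV) P) g
    = measure_pmf.expectation P (\<lambda>x. \<Sum>v\<in>UNIV. g (v, x)) / real CARD('v)"
proof -
  have "measure_pmf.expectation (pair_pmf (pmf_of_set UNIV) P) g
      = (\<Sum>(v, x)\<in>UNIV \<times> UNIV. g (v, x) * (pmf P x / real CARD('v)))"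
    by (subst integral_measure_pmf_real[where A = UNIV])
      (auto simp: pmf_pair intro!: sum.cong)
  also have "\<dots> = (\<Sum>x\<in>UNIV. \<Sum>v\<in>UNIV. g (v, x) * (pmf P x / real CARD('v)))"
    by (subst sum.swap) (simp add: sum.cartesian_product)
  finally show ?thesis
    by (simp add: integral_measure_pmf_real[where A = UNIV] sum_distrib_right sum_divide_distrib)
qed

section \<open>Independent copies and their mean distortion\<close>

lemma iid_pmf_map:
  "(iid_pmf (map_pmf h P) :: ('b ^ 'n::finite) pmf) = map_pmf (\<lambda>w. \<chi> i. h (w $ i)) (iid_pmf P)"
proof -
  \<comment> \<open>Mapping with \<open>h\<close> turns the default value into
    \<open>h undefined\<close>; this changes nothing, because every index lies in
    \<open>UNIV\<close>.\<close>
  have "Pi_pmf UNIV undefined (\<lambda>_. map_pmf h P)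
      = Pi_pmf (UNIV :: 'n set) (h undefined) (\<lambda>_. map_pmf h P)"
    by (rule pmf_eqI) (simp add: pmf_Pi)
  also have "\<dots> = map_pmf ((\<circ>) h) (Pi_pmf UNIV undefined (\<lambda>_. P))"
    by (rule Pi_pmf_map) auto
  finally show ?thesis
    by (simp add: iid_pmf_def map_pmf_comp o_def)
qed

lemma iid_pmf_component:
  fixes i :: "'n::finite"
  shows "map_pmf (\<lambda>w. w $ i) (iid_pmf P) = P"
  using Pi_pmf_component[of "UNIV :: 'n set" i undefined "\<lambda>_. P"]
  by (simp add: iid_pmf_def map_pmf_comp)

lemma snd_reconstruction_source:
  "map_pmf snd (reconstruction_source_pmf P) = iid_pmf (map_pmf fst P)"
  by (simp add: reconstruction_source_pmf_def iid_pmf_map map_pmf_comp)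

text \<open>Every coordinate of the product has law \<open>P\<close>, so by linearity this is an
  average of equal symbolwise means.\<close>

lemma expectation_avg_distortion:
  fixes P :: "('x::finite \<times> 'y::finite) pmf"
  shows "measure_pmf.expectation (reconstruction_source_pmf P :: (('y ^ 'n::finite) \<times> ('x ^ 'n)) pmf)
      (\<lambda>(y, x). avg_distortion dsym x y)
    = measure_pmf.expectation P (\<lambda>(x, y). dsym x y)"
proof -
  have comp: "measure_pmf.expectation (iid_pmf P :: (('x \<times> 'y) ^ 'n) pmf)
      (\<lambda>w. dsym (fst (w $ i)) (snd (w $ i))) = measure_pmf.expectation P (\<lambda>(x, y). dsym x y)" for i
    \<comment> \<open>The first occurrence of \<open>P\<close> sits inside \<open>iid_pmf P\<close>;
      only the one on the right-hand side is to be rewritten.\<close>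
    by (subst (2) iid_pmf_component[of i P, symmetric])
      (simp add: case_prod_beta)
  have "measure_pmf.expectation (reconstruction_source_pmf P :: (('y ^ 'n) \<times> ('x ^ 'n)) pmf)
      (\<lambda>(y, x). avg_distortion dsym x y)
    = measure_pmf.expectation (iid_pmf P :: (('x \<times> 'y) ^ 'n) pmf)
      (\<lambda>w. 1 / real CARD('n) * (\<Sum>i\<in>UNIV. dsym (fst (w $ i)) (snd (w $ i))))"
    by (simp add: reconstruction_source_pmf_def avg_distortion_def)
  also have "\<dots> = 1 / real CARD('n) * (\<Sum>i\<in>UNIV.
      measure_pmf.expectation (iid_pmf P :: (('x \<times> 'y) ^ 'n) pmf)
        (\<lambda>w. dsym (fst (w $ i)) (snd (w $ i))))"
    by (subst integral_mult_right_zero, subst Bochner_Integration.integral_sum)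
      (auto intro: integrable_measure_pmf_finite)
  finally show ?thesis
    by (simp add: comp)
qed

lemma avg_distortion_bounds:
  fixes x :: "'x ^ 'n::finite"
  assumes "\<And>x x'. 0 \<le> dsym x x'" and "\<And>x x'. dsym x x' \<le> 1"
  shows "0 \<le> avg_distortion dsym x y" "avg_distortion dsym x y \<le> 1"
proof -
  show "0 \<le> avg_distortion dsym x y"
    using assms by (simp add: avg_distortion_def sum_nonneg)
  have "(\<Sum>i\<in>UNIV. dsym (x $ i) (y $ i)) \<le> (\<Sum>i\<in>(UNIV :: 'n set). 1)"
    by (intro sum_mono assms)
  then show "avg_distortion dsym x y \<le> 1"
    by (simp add: avg_distortion_def divide_simps)
qed

section \<open>Codebooks and fibre distortions\<close>

text \<open>The encoder sends \<open>x\<close> to the index of a nearest codeword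
  \<open>c x\<close>; the numbering \<open>e\<close> makes the code a set of naturals, and the
  decoder inverts it.\<close>

lemma lossy_compression_from_codebook:
  fixes P :: "'a pmf" and S :: "'b set"
  assumes "finite S" "S \<noteq> {}" "measure_pmf.expectation P (\<lambda>x. Min (d x ` S)) \<le> D0"
  shows "\<exists>(C :: nat set) E D. lossy_compression_scheme P d C E D (log 2 (real (card S))) D0"
proof -
  obtain e where e: "bij_betw e S {0..<card S}"
    using ex_bij_betw_finite_nat[OF assms(1)] by blast
  have "\<exists>y\<in>S. d x y = Min (d x ` S)" for x
    using Min_in[of "d x ` S"] assms(1,2) by (metis finite_imageI image_iff image_is_empty)
  then obtain c where c: "\<And>x. c x \<in> S" "\<And>x. d x (c x) = Min (d x ` S)"
    by metis
  have "lossy_compression_scheme P d {0..<card S} (e \<circ> c) (inv_into S e)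
      (log 2 (real (card S))) D0"
    using c assms(3) bij_betwE[OF e] bij_betw_imp_inj_on[OF e]
    by (auto simp: lossy_compression_scheme_def inv_into_f_f)
  then show ?thesis by blast
qed

text \<open>The value 1 off the range keeps the function within [0, 1] when \<open>d\<close> is, and
  pays for the \<open>K - 1\<close> blocks per fibre that are only bounded by 1.\<close>

definition fibre_distortion :: "('x \<Rightarrow> 'y \<Rightarrow> real) \<Rightarrow> ('y \<Rightarrow> 'v) \<Rightarrow> 'x \<Rightarrow> 'v \<Rightarrow> real" where
  "fibre_distortion d f x v = (if v \<in> range f then Min (d x ` (f -` {v})) else 1)"

lemma fibre_distortion_bounds:
  fixes d :: "'x \<Rightarrow> 'y::finite \<Rightarrow> real"
  assumes "\<And>x y. 0 \<le> d x y" "\<And>x y. d x y \<le> 1"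
  shows "0 \<le> fibre_distortion d f x v" "fibre_distortion d f x v \<le> 1"
proof -
  have "Min (d x ` (f -` {v})) \<in> d x ` (f -` {v})" if "v \<in> range f"
    using that by (intro Min_in) auto
  then show "0 \<le> fibre_distortion d f x v" "fibre_distortion d f x v \<le> 1"
    using assms by (auto simp: fibre_distortion_def)
qed

lemma fibre_distortion_le:
  fixes d :: "'x \<Rightarrow> 'y::finite \<Rightarrow> real"
  shows "fibre_distortion d f x (f y) \<le> d x y"
  by (auto simp: fibre_distortion_def)

text \<open>\<open>fibre_distortion\<close> is a test function with values in [0, 1], so replacing
  the law of \<open>(f y, z)\<close> by the ideal one raises its mean by at most
  \<open>\<epsilon>\<close>.\<close>

lemma privacy_amplification_fibre_distortion:
  fixes Q :: "('y::finite \<times> 'z::finite) pmf" and f :: "'y \<Rightarrow> 'v::finite"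
  assumes d: "\<And>x y. 0 \<le> d x y" "\<And>x y. d x y \<le> 1"
    and pa: "privacy_amplification Q f k \<epsilon>"
    and D: "measure_pmf.expectation Q (\<lambda>(y, x). d x y) \<le> D"
  shows "measure_pmf.expectation (map_pmf snd Q) (\<lambda>x. \<Sum>v\<in>UNIV. fibre_distortion d f x v)
    \<le> real CARD('v) * (D + \<epsilon>)"
proof -
  let ?g = "\<lambda>(v, x). fibre_distortion d f x v"
  let ?T = "map_pmf (\<lambda>(y, z). (f y, z)) Q"
  let ?R = "pair_pmf (pmf_of_set (UNIV :: 'v set)) (map_pmf snd Q)"
  have "measure_pmf.expectation ?R ?g \<le> measure_pmf.expectation ?T ?g + variational_distance ?T ?R"
    by (rule expectation_le_variational_distance) (auto simp: fibre_distortion_bounds d)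
  also have "measure_pmf.expectation ?T ?g \<le> measure_pmf.expectation Q (\<lambda>(y, x). d x y)"
    unfolding integral_map_pmf by (rule expectation_mono_finite) (auto intro: fibre_distortion_le)
  finally have "measure_pmf.expectation ?R ?g \<le> D + \<epsilon>"
    using pa D by (simp add: privacy_amplification_def)
  then show ?thesis
    by (simp add: expectation_uniform_pair field_simps)
qed

text \<open>An averaging argument over all blocks of all fibres: some block does no worse than the
  mean.\<close>

lemma good_block:
  fixes P :: "'x::finite pmf" and f :: "'y::finite \<Rightarrow> 'v::finite"
  assumes d: "\<And>x y. d x y \<le> 1"
    and fibre: "\<And>w. w \<in> range f \<Longrightarrow> card (f -` {w}) = K * M"
    and V: "CARD('v) = K * card (range f)" and "0 < M"
    and D: "measure_pmf.expectation P (\<lambda>x. \<Sum>v\<in>UNIV. fibre_distortion d f x v) \<le> real CARD('v) * D"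
  shows "\<exists>S. card S = M \<and> measure_pmf.expectation P (\<lambda>x. Min (d x ` S)) \<le> D"
proof -
  have "\<forall>w\<in>range f. \<exists>B. (\<forall>i<K. card (B i) = M) \<and> f -` {w} = (\<Union>i<K. B i)"
  proof
    fix w assume "w \<in> range f"
    show "\<exists>B. (\<forall>i<K. card (B i) = M) \<and> f -` {w} = (\<Union>i<K. B i)"
      by (rule equal_blocks[OF _ fibre[OF \<open>w \<in> range f\<close>]]) auto
  qed
  then obtain B where B: "\<And>w i. w \<in> range f \<Longrightarrow> i < K \<Longrightarrow> card (B w i) = M"
      "\<And>w. w \<in> range f \<Longrightarrow> f -` {w} = (\<Union>i<K. B w i)"
    by metis
  let ?I = "range f \<times> {..<K}"
  let ?F = "\<lambda>S. measure_pmf.expectation P (\<lambda>x. Min (d x ` S))"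
  have pointwise: "(\<Sum>(w, i)\<in>?I. Min (d x ` B w i)) \<le> (\<Sum>v\<in>UNIV. fibre_distortion d f x v)" for x
  proof -
    have "(\<Sum>(w, i)\<in>?I. Min (d x ` B w i)) = (\<Sum>w\<in>range f. \<Sum>i<K. Min (d x ` B w i))"
      by (simp add: sum.cartesian_product)
    also have "\<dots> \<le> (\<Sum>w\<in>range f. real K - 1 + fibre_distortion d f x w)"
    proof (rule sum_mono)
      fix w assume w: "w \<in> range f"
      have "(\<Sum>i<K. Min (d x ` B w i)) \<le> real K - 1 + Min (d x ` (f -` {w}))"
      proof (rule sum_Min_blocks_le[OF B(2)[OF w]])
        show "f -` {w} \<noteq> {}" using w by auto
        show "B w i \<noteq> {}" if "i < K" for i
          using B(1)[OF w that] \<open>0 < M\<close> by auto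
      qed (auto simp: d)
      then show "(\<Sum>i<K. Min (d x ` B w i)) \<le> real K - 1 + fibre_distortion d f x w"
        using w by (simp add: fibre_distortion_def)
    qed
    also have "\<dots> = real CARD('v) - real (card (range f)) + (\<Sum>w\<in>range f. fibre_distortion d f x w)"
      by (simp add: V sum.distrib sum_subtractf left_diff_distrib mult.commute)
    \<comment> \<open>Each point outside the range has \<open>fibre_distortion\<close> 1, so the
      difference of cardinalities becomes a sum.\<close>
    also have "\<dots> = (\<Sum>v\<in>- range f. fibre_distortion d f x v) + (\<Sum>w\<in>range f. fibre_distortion d f x w)"
    proof -
      have "(\<Sum>v\<in>- range f. fibre_distortion d f x v) = real (card (- range f))"
        by (subst sum.cong[OF refl, of _ _ "\<lambda>_. 1"]) (auto simp: fibre_distortion_def)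
      moreover have "card (- range f) = CARD('v) - card (range f)"
        by (simp add: Compl_eq_Diff_UNIV card_Diff_subset)
      ultimately show ?thesis
        by (simp add: of_nat_diff card_mono)
    qed
    also have "\<dots> = (\<Sum>v\<in>UNIV. fibre_distortion d f x v)"
      using sum.union_disjoint[of "- range f" "range f" "fibre_distortion d f x"]
      by (simp add: Compl_partition2)
    finally show ?thesis .
  qed
  have "(\<Sum>(w, i)\<in>?I. ?F (B w i)) = measure_pmf.expectation P (\<lambda>x. \<Sum>(w, i)\<in>?I. Min (d x ` B w i))"
    by (subst Bochner_Integration.integral_sum)
      (auto simp: case_prod_beta intro: integrable_measure_pmf_finite)
  also have "\<dots> \<le> measure_pmf.expectation P (\<lambda>x. \<Sum>v\<in>UNIV. fibre_distortion d f x v)"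
    by (rule expectation_mono_finite[OF pointwise])
  \<comment> \<open>The index set \<open>?I\<close> has \<open>K * card (range f) = CARD('v)\<close>
    elements.\<close>
  also have "\<dots> \<le> (\<Sum>(w, i)\<in>?I. D)"
    using D by (simp add: V mult.commute)
  finally have le: "(\<Sum>(w, i)\<in>?I. ?F (B w i)) \<le> (\<Sum>(w, i)\<in>?I. D)" .
  have "0 < K"
    using V by (metis gr0I mult_zero_left zero_less_card_finite less_irrefl)
  then have "?I \<noteq> {}" by auto
  have "\<exists>w\<in>range f. \<exists>i<K. ?F (B w i) \<le> D"
  proof (rule ccontr)
    assume "\<not> ?thesis"
    then have "D < ?F (B w i)" if "w \<in> range f" "i < K" for w i
      using that by (meson not_le)
    then have "(\<Sum>(w, i)\<in>?I. D) < (\<Sum>(w, i)\<in>?I. ?F (B w i))"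
      using \<open>?I \<noteq> {}\<close> by (intro sum_strict_mono) auto
    then show False using le by simp
  qed
  then show ?thesis using B(1) by blast
qed

text \<open>The bound on \<open>k\<close> makes the code length attainable:
  \<open>log 2 (real (card C))\<close> is never negative. The explicit \<open>scaleV\<close> admits
  any finite vector space over \<open>bit\<close> as codomain.\<close>

theorem corollary1:
  fixes PX :: "'x::finite pmf"
    and PXX' :: "('x \<times> bit) pmf"
    and dsym :: "'x \<Rightarrow> bit \<Rightarrow> real"
    and dbar k \<epsilon> :: real
    and scaleV :: "bit \<Rightarrow> 'v \<Rightarrow> 'v::{finite, ab_group_add}"
    and f :: "bit ^ 'n::finite \<Rightarrow> 'v"
  assumes "\<And>x x'. 0 \<le> dsym x x'" and "\<And>x x'. dsym x x' \<le> 1"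
    and "dbar \<le> 1"
    and "map_pmf fst PXX' = PX"
    and "measure_pmf.expectation PXX' (\<lambda>(x, x'). dsym x x') \<le> dbar"
    and "Vector_Spaces.linear (*s) scaleV f"
    and "privacy_amplification
           (reconstruction_source_pmf PXX' :: ((bit ^ 'n) \<times> ('x ^ 'n)) pmf) f k \<epsilon>"
    and "k \<le> real CARD('n)"
  shows "\<exists>(C :: nat set) (E :: 'x ^ 'n \<Rightarrow> nat) (D :: nat \<Rightarrow> bit ^ 'n).
           lossy_compression_scheme (iid_pmf PX) (avg_distortion dsym) C E D
             (real CARD('n) - k) (dbar + \<epsilon>)"
proof -
  interpret Vector_Spaces.linear "(*s)" scaleV f by fact
  let ?n = "CARD('n)"
  let ?d = "avg_distortion dsym :: 'x ^ 'n \<Rightarrow> bit ^ 'n \<Rightarrow> real"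
  let ?Q = "reconstruction_source_pmf PXX' :: ((bit ^ 'n) \<times> ('x ^ 'n)) pmf"
  note bounds = avg_distortion_bounds[OF assms(1,2)]
  have "(UNIV :: bit set) = {0, 1}"
    by (auto intro: bit_not_zero_iff[THEN iffD1])
  then have bit: "CARD(bit) = 2"
    by (metis card_2_iff zero_neq_one)
  have k: "k = log 2 (real CARD('v))"
    using assms(7) by (simp add: privacy_amplification_def)
  \<comment> \<open>A finite space over \<open>bit\<close> has a power of two as its size, so
    \<open>k\<close> is the natural number \<open>j\<close> and \<open>2 ^ (?n - j)\<close> is the
    exact codebook size.\<close>
  obtain j where j: "CARD('v) = 2 ^ j"
    using card_subspace_bit[OF vs2.vector_space_axioms vs2.subspace_UNIV] by auto
  have "vs2.subspace (range f)"
    using subspace_image[OF vec.subspace_UNIV] .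
  then obtain r where r: "card (range f) = 2 ^ r"
    using card_subspace_bit[OF vs2.vector_space_axioms] by auto
  have kj: "k = real j"
    by (simp add: k j log_nat_power)
  then have jn: "j \<le> ?n" using assms(8) by simp
  have "(2 :: nat) ^ r \<le> 2 ^ j"
    unfolding r[symmetric] j[symmetric] by (intro card_mono) auto
  then have rj: "r \<le> j" by simp
  have "\<exists>S. card S = 2 ^ (?n - j) \<and>
      measure_pmf.expectation (iid_pmf PX) (\<lambda>x. Min (?d x ` S)) \<le> dbar + \<epsilon>"
  proof (rule good_block)
    show "CARD('v) = 2 ^ (j - r) * card (range f)"
      using rj by (simp add: j r flip: power_add)
    \<comment> \<open>A fibre has \<open>2 ^ (?n - r)\<close> points, and
      \<open>?n - r = (j - r) + (?n - j)\<close> because \<open>r \<le> j\<close> and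
      \<open>j \<le> ?n\<close>.\<close>
    show "card (f -` {w}) = 2 ^ (j - r) * 2 ^ (?n - j)" if "w \<in> range f" for w
    proof -
      have "card (f -` {w}) * 2 ^ r = (2 ^ (j - r) * 2 ^ (?n - j)) * 2 ^ r"
        using card_fibre[of f w, OF add that] rj jn by (simp add: r bit flip: power_add)
      then show ?thesis by simp
    qed
    have "measure_pmf.expectation (map_pmf snd ?Q) (\<lambda>x. \<Sum>v\<in>UNIV. fibre_distortion ?d f x v)
        \<le> real CARD('v) * (dbar + \<epsilon>)"
      using assms(5,7)
      by (intro privacy_amplification_fibre_distortion)
        (auto simp: bounds expectation_avg_distortion)
    then show "measure_pmf.expectation (iid_pmf PX) (\<lambda>x. \<Sum>v\<in>UNIV. fibre_distortion ?d f x v)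
        \<le> real CARD('v) * (dbar + \<epsilon>)"
      by (simp add: snd_reconstruction_source assms(4))
  qed (auto simp: bounds)
  then obtain S where S: "card S = 2 ^ (?n - j)"
      "measure_pmf.expectation (iid_pmf PX) (\<lambda>x. Min (?d x ` S)) \<le> dbar + \<epsilon>"
    by blast
  have "S \<noteq> {}" using S(1) by auto
  moreover have "log 2 (real (card S)) = real ?n - k"
    using jn by (simp add: S(1) kj log_nat_power of_nat_diff)
  ultimately show ?thesis
    using lossy_compression_from_codebook[of S "iid_pmf PX" ?d "dbar + \<epsilon>"] S(2) by simp
qed

end
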